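(* Let $n\ge 1$ bidders have valuations $\mathbf{v}=(v_1,\dots,v_n)\in\mathbb{R}^n$. Let $\mathbf{a}=(a_1,\dots,a_n)$ be additive bid augmentations and $\mathbf{r}=(r_1,\dots,r_n)$ additive price reductions, with $a_i,r_i\ge 0$ for all $i$, and suppose $\mathbf{a}=\mathbf{r}$. Then the first-price auction with additive bid augmentations $\mathbf{a}$ and the first-price auction with additive price reductions $\mathbf{r}$ have corresponding Nash equilibria (if either has an equilibrium), with every bidder having the same utility under both forms of discounting. That is, there is a bijection $\Phi$ from the set of Nash equilibria of the price-reduction auction onto the set of Nash equilibria of the bid-augmentation auction (in particular, one set is nonempty if and only if the other is) such that, for every Nash equilibrium $\mathbf{b}^*$ of the price-reduction auction and every bidder $i$, $$z_i^+(\mathbf{v},\mathbf{b}^*,\mathbf{r})=u_i^+(\mathbf{v},\Phi(\mathbf{b}^* ),\mathbf{a}).$$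
   Context: A bid vector is $\mathbf{b}=(b_1,\dots,b_n)\in\mathbb{R}^n$, where bidder $i$ chooses $b_i\in\mathbb{R}$. For a vector $\mathbf{x}\in\mathbb{R}^n$, $p_i(\mathbf{x})$ denotes the probability that bidder $i$ wins when the winner is selected according to $\mathbf{x}$: $p_i(\mathbf{x})=1$ if $x_i>x_j$ for all $j\ne i$; $p_i(\mathbf{x})=0$ if $x_j>x_i$ for some $j$; and $p_i(\mathbf{x})=1/k$ if exactly $k$ bidders, including $i$, tie for the maximum entry of $\mathbf{x}$. In the first-price auction with additive bid augmentations $\mathbf{a}$, the winner is selected using $\mathbf{b}+\mathbf{a}$ but pays only their original bid, so bidder $i$ has utility $u_i^+(\mathbf{v},\mathbf{b},\mathbf{a})=p_i(\mathbf{b}+\mathbf{a})\,(v_i-b_i)$. In the first-price auction with additive price reductions $\mathbf{r}$, the winner is selected using $\mathbf{b}$ and pays their bid minus their reduction, so bidder $i$ has utility $z_i^+(\mathbf{v},\mathbf{b},\mathbf{r})=p_i(\mathbf{b})\,(v_i-b_i+r_i)$. For fixed $\mathbf{v}$ and fixed discounts, a bid vector is a (pure) Nash equilibrium if no single bidder can strictly increase their own utility by changing only their own bid. *)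

theory Defs
  imports "HOL-Analysis.Analysis"
begin

text \<open>
  The bidders are the elements of a finite type \<open>'n\<close>, so a vector indexed by
  the bidders has type \<open>real ^ 'n\<close>.  There is at least one bidder, since types
  are nonempty.
\<close>

text \<open>
  The last case is reached only when bidder \<open>i\<close> attains the maximum entry of
  \<open>x\<close>; the set there consists of all bidders attaining it.
\<close>
definition win_prob :: "real ^ 'n::finite \<Rightarrow> 'n \<Rightarrow> real" where
  "win_prob x i =
     (if \<forall>j. j \<noteq> i \<longrightarrow> x $ i > x $ j then 1
      else if \<exists>j. x $ j > x $ i then 0
      else 1 / real (card {j. \<forall>l. x $ l \<le> x $ j}))"

definition augmentation_utility ::
    "real ^ 'n::finite \<Rightarrow> real ^ 'n \<Rightarrow> real ^ 'n \<Rightarrow> 'n \<Rightarrow> real" where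
  "augmentation_utility v b a i = win_prob (b + a) i * (v $ i - b $ i)"

definition reduction_utility ::
    "real ^ 'n::finite \<Rightarrow> real ^ 'n \<Rightarrow> real ^ 'n \<Rightarrow> 'n \<Rightarrow> real" where
  "reduction_utility v b r i = win_prob b i * (v $ i - b $ i + r $ i)"

definition replace_bid :: "real ^ 'n::finite \<Rightarrow> 'n \<Rightarrow> real \<Rightarrow> real ^ 'n" where
  "replace_bid b i t = (\<chi> j. if j = i then t else b $ j)"

text \<open>
  Pure Nash equilibria of the game in which every bidder chooses a real bid and
  bidder \<open>i\<close> has utility \<open>u b i\<close> under the bid vector \<open>b\<close>.
\<close>
definition nash_equilibria ::
    "(real ^ 'n::finite \<Rightarrow> 'n \<Rightarrow> real) \<Rightarrow> (real ^ 'n) set" where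
  "nash_equilibria u = {b. \<not> (\<exists>i t. u (replace_bid b i t) i > u b i)}"

definition augmentation_equilibria ::
    "real ^ 'n::finite \<Rightarrow> real ^ 'n \<Rightarrow> (real ^ 'n) set" where
  "augmentation_equilibria v a = nash_equilibria (\<lambda>b. augmentation_utility v b a)"

definition reduction_equilibria ::
    "real ^ 'n::finite \<Rightarrow> real ^ 'n \<Rightarrow> (real ^ 'n) set" where
  "reduction_equilibria v r = nash_equilibria (\<lambda>b. reduction_utility v b r)"

end

theory Submission
  imports Defs
begin

text \<open>
  Bidding \<open>b\<close> under price reductions \<open>r\<close> amounts to bidding \<open>b - r\<close> under bid augmentations
  \<open>r\<close>.  This translation acts coordinatewise, so it identifies unilateral deviations in the two
  games and hence their equilibria.
\<close>

lemma replace_bid_diff: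
  "replace_bid b i t - c = replace_bid (b - c) i (t - c $ i)"
  by (simp add: replace_bid_def vec_eq_iff)

lemma nash_equilibria_translate_iff:
  "b \<in> nash_equilibria (\<lambda>b. u (b - c)) \<longleftrightarrow> b - c \<in> nash_equilibria u"
proof -
  \<comment> \<open>As \<open>t\<close> runs over all reals, so does \<open>t - c $ i\<close>: a
    deviation to \<open>s\<close> in the translated game comes from
    \<open>t = s + c $ i\<close>.\<close>
  have "(\<exists>t. u (replace_bid (b - c) i (t - c $ i)) i > u (b - c) i) \<longleftrightarrow>
        (\<exists>s. u (replace_bid (b - c) i s) i > u (b - c) i)" for i
    by (metis add_diff_cancel)
  then show ?thesis
    unfolding nash_equilibria_def replace_bid_diff mem_Collect_eq by blast
qed

lemma bij_betw_nash_equilibria_translate: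
  "bij_betw (\<lambda>b. b - c) (nash_equilibria (\<lambda>b. u (b - c))) (nash_equilibria u)"
  by (rule bij_betw_byWitness[where f' = "\<lambda>b. b + c"])
     (auto simp: nash_equilibria_translate_iff)

text \<open>Since \<open>(b - r) + r = b\<close>, both games select the winner from the same vector,
  and in both a winning bidder \<open>i\<close> pays \<open>b $ i - r $ i\<close>.\<close>

lemma reduction_utility_eq_augmentation_utility:
  "reduction_utility v b r i = augmentation_utility v (b - r) r i"
  by (simp add: reduction_utility_def augmentation_utility_def algebra_simps)

theorem theorem2p1:
  fixes v a r :: "real ^ 'n::finite"
  assumes "\<And>i. a $ i \<ge> 0" and "\<And>i. r $ i \<ge> 0" and "a = r"
  shows "\<exists>\<Phi>. bij_betw \<Phi> (reduction_equilibria v r) (augmentation_equilibria v a) \<and>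
           (\<forall>b \<in> reduction_equilibria v r. \<forall>i.
              reduction_utility v b r i = augmentation_utility v (\<Phi> b) a i)"
proof -
  \<comment> \<open>\<open>nash_equilibria\<close> takes the whole utility function, so the equality
    is lifted to functions; this exposes the form \<open>u (b - c)\<close> with
    \<open>c = r\<close>.\<close>
  have utility: "(\<lambda>b. reduction_utility v b r) = (\<lambda>b. augmentation_utility v (b - r) r)"
    by (intro ext) (rule reduction_utility_eq_augmentation_utility)
  have "bij_betw (\<lambda>b. b - r) (reduction_equilibria v r) (augmentation_equilibria v r)"
    unfolding reduction_equilibria_def augmentation_equilibria_def utility
    by (rule bij_betw_nash_equilibria_translate)
  then show ?thesis
    using \<open>a = r\<close> reduction_utility_eq_augmentation_utility by blast
qed

end
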